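(* Let $h_{b^2}:\chi(\Lambda_0)\to\chi(\Lambda_0)$ be the map induced by the pure braid $b^2$, namely $$\big[(M_0,U_1,U_2,\widehat M)\big]\longmapsto\big[\big((U_1U_2\widehat M)^{-1}M_0(U_1U_2\widehat M),\,U_1,\,U_2,\,\widehat M\big)\big].$$ Then $h_{b^2}$ fixes $\lambda$, $t_0$ and $t_1$, and in the trace coordinates $(s,x,y)$ it is given by $$s'=s,$$ $$x'=(\lambda^{-1}-\lambda+\lambda s)^2x+(\lambda^{-1}-\lambda+\lambda s)y-x-(\lambda^{-1}-\lambda+\lambda s)(s\,t_1+\lambda t_0+\lambda^{-1}t_0)+(s\,t_0+\lambda t_1+\lambda^{-1}t_1),$$ $$y'=-(\lambda^{-1}-\lambda+\lambda s)x-y+(s\,t_1+\lambda t_0+\lambda^{-1}t_0).$$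
   Context: The wild character variety $\chi(\Lambda_0)$ is the set of 4-tuples $(M_0,U_1,U_2,\widehat M)$ with $M_0\in\mathrm{SL}_2(\mathbb{C})$, $U_1=\begin{pmatrix}1&u_1\\ 0&1\end{pmatrix}$, $U_2=\begin{pmatrix}1&0\\ u_2&1\end{pmatrix}$, $\widehat M=\begin{pmatrix}\lambda&0\\ 0&\lambda^{-1}\end{pmatrix}$ ($u_1,u_2\in\mathbb{C}$, $\lambda\in\mathbb{C}^*$), modulo simultaneous conjugation by the matrices $D_\alpha=\begin{pmatrix}\alpha&0\\ 0&\alpha^{-1}\end{pmatrix}$, $\alpha\in\mathbb{C}^*$. The matrix $M_1$ is determined by $M_0U_1U_2\widehat M M_1=I$. The trace coordinates are: $\lambda$ (first eigenvalue of $\widehat M$), $t_0=\operatorname{tr}(M_0)$, $t_1=\operatorname{tr}(M_1)=\operatorname{tr}(M_0U_1U_2\widehat M)$, $s=\operatorname{tr}(U_1U_2)$, $x=\operatorname{tr}(M_0U_1U_2)$, $y=\operatorname{tr}(M_0\widehat M)$. Primed quantities are the coordinates of the image point. *)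

theory Defs
  imports "HOL-Analysis.Analysis"
begin

type_synonym mat2 = "complex^2^2"

definition mat22 :: "complex \<Rightarrow> complex \<Rightarrow> complex \<Rightarrow> complex \<Rightarrow> mat2" where
  "mat22 a b c d = vector [vector [a, b], vector [c, d]]"

definition diag_mat :: "complex \<Rightarrow> mat2" where
  "diag_mat \<alpha> = mat22 \<alpha> 0 0 (inverse \<alpha>)"

text \<open>Linear monodromy data \<open>(M\<^sub>0, U\<^sub>1, U\<^sub>2, Mh)\<close> before passing to the quotient.\<close>

type_synonym wild_data = "mat2 \<times> mat2 \<times> mat2 \<times> mat2"

definition wild_reps :: "wild_data set" where
  "wild_reps = {(M0, U1, U2, Mh) | M0 U1 U2 Mh.
     det M0 = 1 \<and>
     (\<exists>u1. U1 = mat22 1 u1 0 1) \<and>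
     (\<exists>u2. U2 = mat22 1 0 u2 1) \<and>
     (\<exists>l. l \<noteq> 0 \<and> Mh = diag_mat l)}"

definition conj_diag :: "complex \<Rightarrow> mat2 \<Rightarrow> mat2" where
  "conj_diag \<alpha> A = diag_mat \<alpha> ** A ** matrix_inv (diag_mat \<alpha>)"

fun conj_data :: "complex \<Rightarrow> wild_data \<Rightarrow> wild_data" where
  "conj_data \<alpha> (M0, U1, U2, Mh) =
     (conj_diag \<alpha> M0, conj_diag \<alpha> U1, conj_diag \<alpha> U2, conj_diag \<alpha> Mh)"

definition wild_rel :: "(wild_data \<times> wild_data) set" where
  "wild_rel = {(r, r'). r \<in> wild_reps \<and> r' \<in> wild_reps \<and>
     (\<exists>\<alpha>. \<alpha> \<noteq> 0 \<and> r' = conj_data \<alpha> r)}"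

definition wild_char_variety :: "wild_data set set" where
  "wild_char_variety = wild_reps // wild_rel"

definition wild_class :: "wild_data \<Rightarrow> wild_data set" where
  "wild_class r = wild_rel `` {r}"

fun braid_sq :: "wild_data \<Rightarrow> wild_data" where
  "braid_sq (M0, U1, U2, Mh) =
     (matrix_inv (U1 ** U2 ** Mh) ** M0 ** (U1 ** U2 ** Mh), U1, U2, Mh)"

text \<open>The map induced on classes; independence of the representative is
  \<open>h_b2_class\<close> below.\<close>

definition h_b2 :: "wild_data set \<Rightarrow> wild_data set" where
  "h_b2 c = (\<Union>r\<in>c. wild_class (braid_sq r))"

text \<open>The matrix \<open>M\<^sub>1\<close> is the solution of \<open>M\<^sub>0 U\<^sub>1 U\<^sub>2 Mh M\<^sub>1 = I\<close>.\<close>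

fun M1_of :: "wild_data \<Rightarrow> mat2" where
  "M1_of (M0, U1, U2, Mh) = matrix_inv (M0 ** U1 ** U2 ** Mh)"

fun rep_lam :: "wild_data \<Rightarrow> complex" where
  "rep_lam (M0, U1, U2, Mh) = Mh $ 1 $ 1"

fun rep_t0 :: "wild_data \<Rightarrow> complex" where
  "rep_t0 (M0, U1, U2, Mh) = trace M0"

definition rep_t1 :: "wild_data \<Rightarrow> complex" where
  "rep_t1 r = trace (M1_of r)"

fun rep_s :: "wild_data \<Rightarrow> complex" where
  "rep_s (M0, U1, U2, Mh) = trace (U1 ** U2)"

fun rep_x :: "wild_data \<Rightarrow> complex" where
  "rep_x (M0, U1, U2, Mh) = trace (M0 ** U1 ** U2)"

fun rep_y :: "wild_data \<Rightarrow> complex" where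
  "rep_y (M0, U1, U2, Mh) = trace (M0 ** Mh)"

text \<open>The function on classes induced by a function that is constant on each class;
  see \<open>on_class_wild_class\<close> below.\<close>

definition on_class :: "(wild_data \<Rightarrow> complex) \<Rightarrow> wild_data set \<Rightarrow> complex" where
  "on_class f c = the_elem (f ` c)"

definition coord_lam where "coord_lam = on_class rep_lam"
definition coord_t0 where "coord_t0 = on_class rep_t0"
definition coord_t1 where "coord_t1 = on_class rep_t1"
definition coord_s where "coord_s = on_class rep_s"
definition coord_x where "coord_x = on_class rep_x"
definition coord_y where "coord_y = on_class rep_y"


subsection \<open>Well-definedness\<close>

lemma mat22_nth [simp]:
  "mat22 a b c d $ 1 $ 1 = a" "mat22 a b c d $ 1 $ 2 = b"
  "mat22 a b c d $ 2 $ 1 = c" "mat22 a b c d $ 2 $ 2 = d"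
  by (simp_all add: mat22_def)

lemma mat22_eta: "mat22 (A $ 1 $ 1) (A $ 1 $ 2) (A $ 2 $ 1) (A $ 2 $ 2) = A"
  by (simp add: vec_eq_iff forall_2)

lemma mat22_eq_iff [simp]:
  "mat22 a b c d = mat22 a' b' c' d' \<longleftrightarrow> a = a' \<and> b = b' \<and> c = c' \<and> d = d'"
  by (auto simp: vec_eq_iff forall_2)

lemma mat22_mult [simp]:
  "mat22 a b c d ** mat22 a' b' c' d' =
     mat22 (a*a' + b*c') (a*b' + b*d') (c*a' + d*c') (c*b' + d*d')"
  by (simp add: vec_eq_iff forall_2 matrix_matrix_mult_def sum_2)

lemma mat22_one: "(mat 1 :: mat2) = mat22 1 0 0 1"
  by (simp add: vec_eq_iff forall_2 mat_def)

lemma mat22_det [simp]: "det (mat22 a b c d) = a*d - b*c"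
  by (simp add: det_2)

lemma mat22_trace [simp]: "trace (mat22 a b c d) = a + d"
  by (simp add: trace_def sum_2)

lemma matrix_inv_eqI:
  fixes A B :: mat2
  assumes "A ** B = mat 1"
  shows "matrix_inv A = B"
proof -
  have BA: "B ** A = mat 1"
    using assms by (simp add: matrix_left_right_inverse)
  hence "A ** matrix_inv A = mat 1 \<and> matrix_inv A ** A = mat 1"
    unfolding matrix_inv_def using assms by (intro someI_ex[of "\<lambda>C. A ** C = mat 1 \<and> C ** A = mat 1"]) blast
  thus ?thesis
    by (metis BA matrix_mul_assoc matrix_mul_lid matrix_mul_rid)
qed

lemma matrix_inv_mat22:
  assumes "a*d - b*c = 1"
  shows "matrix_inv (mat22 a b c d) = mat22 d (-b) (-c) a"
  using assms by (intro matrix_inv_eqI) (simp add: mat22_one algebra_simps)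

lemma conj_diag_mat22:
  assumes "\<alpha> \<noteq> 0"
  shows "conj_diag \<alpha> (mat22 a b c d) = mat22 a (\<alpha>^2 * b) (c / \<alpha>^2) d"
  using assms
  by (simp add: conj_diag_def diag_mat_def matrix_inv_mat22 field_simps power2_eq_square)

lemma wild_repsE:
  assumes "r \<in> wild_reps"
  obtains a b c d u1 u2 l where
    "r = (mat22 a b c d, mat22 1 u1 0 1, mat22 1 0 u2 1, diag_mat l)"
    "a*d - b*c = 1" "l \<noteq> 0"
proof -
  obtain M0 u1 u2 l where r: "r = (M0, mat22 1 u1 0 1, mat22 1 0 u2 1, diag_mat l)"
      "det M0 = 1" "l \<noteq> 0"
    using assms by (auto simp: wild_reps_def)
  show ?thesis
    by (rule that[of "M0$1$1" "M0$1$2" "M0$2$1" "M0$2$2"]) (use r in \<open>simp_all add: mat22_eta det_2\<close>)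
qed

lemma wild_repsI:
  assumes "a*d - b*c = 1" "l \<noteq> 0"
  shows "(mat22 a b c d, mat22 1 u1 0 1, mat22 1 0 u2 1, diag_mat l) \<in> wild_reps"
  using assms by (auto simp: wild_reps_def)

lemma conj_data_in_reps:
  assumes "r \<in> wild_reps" "\<alpha> \<noteq> 0"
  shows "conj_data \<alpha> r \<in> wild_reps"
  using assms(1)
proof (cases rule: wild_repsE)
  case (1 a b c d u1 u2 l)
  have "conj_data \<alpha> r = (mat22 a (\<alpha>^2 * b) (c / \<alpha>^2) d,
      mat22 1 (\<alpha>^2 * u1) 0 1, mat22 1 0 (u2 / \<alpha>^2) 1, diag_mat l)"
    using 1 assms(2) by (simp add: conj_diag_mat22 diag_mat_def)
  thus ?thesis using 1 assms(2) by (simp add: wild_repsI)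
qed

lemma equiv_wild_rel: "equiv wild_reps wild_rel"
proof (intro equivI refl_onI symI transI)
  show "wild_rel \<subseteq> wild_reps \<times> wild_reps" by (auto simp: wild_rel_def)
next
  fix r assume "r \<in> wild_reps"
  moreover from this have "r = conj_data 1 r"
    by (cases rule: wild_repsE) (simp add: conj_diag_mat22 diag_mat_def)
  ultimately show "(r, r) \<in> wild_rel"
    unfolding wild_rel_def by (auto intro!: exI[of _ 1])
next
  fix r r' assume "(r, r') \<in> wild_rel"
  then obtain \<alpha> where \<alpha>: "r \<in> wild_reps" "r' \<in> wild_reps" "\<alpha> \<noteq> 0" "r' = conj_data \<alpha> r"
    by (auto simp: wild_rel_def)
  have "r = conj_data (inverse \<alpha>) r'"
    using \<alpha>(1) by (cases rule: wild_repsE)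
      (simp add: \<alpha> conj_diag_mat22 diag_mat_def field_simps)
  moreover have "inverse \<alpha> \<noteq> 0" using \<alpha> by simp
  ultimately show "(r', r) \<in> wild_rel"
    unfolding wild_rel_def using \<alpha>(1,2) by blast
next
  fix r r' r'' assume "(r, r') \<in> wild_rel" "(r', r'') \<in> wild_rel"
  then obtain \<alpha> \<beta> where \<alpha>: "r \<in> wild_reps" "r'' \<in> wild_reps" "\<alpha> \<noteq> 0" "\<beta> \<noteq> 0"
      "r'' = conj_data \<beta> (conj_data \<alpha> r)"
    by (auto simp: wild_rel_def)
  have "r'' = conj_data (\<beta> * \<alpha>) r"
    using \<alpha>(1) by (cases rule: wild_repsE)
      (simp add: \<alpha> conj_diag_mat22 diag_mat_def field_simps)
  moreover have "\<beta> * \<alpha> \<noteq> 0" using \<alpha> by simp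
  ultimately show "(r, r'') \<in> wild_rel"
    unfolding wild_rel_def using \<alpha>(1,2) by blast
qed

lemma braid_sq_in_reps:
  assumes "r \<in> wild_reps"
  shows "braid_sq r \<in> wild_reps"
proof -
  obtain M0 U1 U2 Mh where r: "r = (M0, U1, U2, Mh)" by (cases r) auto
  have d: "det (U1 ** U2 ** Mh) = 1"
    using assms unfolding r by (auto simp: wild_reps_def det_mul diag_mat_def)
  hence "invertible (U1 ** U2 ** Mh)" by (simp add: invertible_det_nz)
  hence "matrix_inv (U1 ** U2 ** Mh) ** (U1 ** U2 ** Mh) = mat 1"
    unfolding invertible_def matrix_inv_def by (rule someI2_ex) auto
  hence "det (matrix_inv (U1 ** U2 ** Mh)) * det (U1 ** U2 ** Mh) = 1"
    by (metis det_I det_mul)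
  with d have "det (matrix_inv (U1 ** U2 ** Mh)) = 1" by simp
  thus ?thesis using assms d by (auto simp: r wild_reps_def det_mul)
qed

lemma braid_sq_conj_data:
  assumes "r \<in> wild_reps" "\<alpha> \<noteq> 0"
  shows "braid_sq (conj_data \<alpha> r) = conj_data \<alpha> (braid_sq r)"
  using assms(1)
proof (cases rule: wild_repsE)
  case (1 a b c d u1 u2 l)
  then show ?thesis using assms(2)
    by (simp add: conj_diag_mat22 diag_mat_def matrix_inv_mat22 field_simps)
qed

lemma wild_class_in [simp]: "r \<in> wild_reps \<Longrightarrow> wild_class r \<in> wild_char_variety"
  by (simp add: wild_class_def wild_char_variety_def quotientI)

lemma h_b2_class:
  assumes "r \<in> wild_reps"
  shows "h_b2 (wild_class r) = wild_class (braid_sq r)"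
proof -
  have "(\<lambda>r. wild_class (braid_sq r)) respects wild_rel"
  proof (rule congruentI)
    fix r r' assume "(r, r') \<in> wild_rel"
    hence "(braid_sq r, braid_sq r') \<in> wild_rel"
      by (auto simp: wild_rel_def braid_sq_conj_data braid_sq_in_reps)
    thus "wild_class (braid_sq r) = wild_class (braid_sq r')"
      unfolding wild_class_def by (rule equiv_class_eq[OF equiv_wild_rel])
  qed
  thus ?thesis
    unfolding h_b2_def by (simp add: wild_class_def UN_equiv_class[OF equiv_wild_rel] assms)
qed

lemma on_class_wild_class:
  assumes "r \<in> wild_reps" "f respects wild_rel"
  shows "on_class f (wild_class r) = f r"
proof -
  have "f ` wild_class r = {f r}"
  proof
    show "f ` wild_class r \<subseteq> {f r}"
      unfolding wild_class_def using congruentD[OF assms(2)] by (metis Image_singleton_iff image_subsetI singletonI)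
    show "{f r} \<subseteq> f ` wild_class r"
      using equiv_class_self[OF equiv_wild_rel assms(1)] unfolding wild_class_def by blast
  qed
  thus ?thesis by (simp add: on_class_def)
qed

lemma coords_respect:
  "rep_lam respects wild_rel" "rep_t0 respects wild_rel" "rep_t1 respects wild_rel"
  "rep_s respects wild_rel" "rep_x respects wild_rel" "rep_y respects wild_rel"
proof -
  have *: "f respects wild_rel"
    if "\<And>r \<alpha>. r \<in> wild_reps \<Longrightarrow> \<alpha> \<noteq> 0 \<Longrightarrow> f (conj_data \<alpha> r) = f r" for f :: "wild_data \<Rightarrow> complex"
    unfolding congruent_def wild_rel_def using that by fastforce
  show "rep_lam respects wild_rel" "rep_t0 respects wild_rel"
    "rep_s respects wild_rel" "rep_x respects wild_rel" "rep_y respects wild_rel"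
    by (rule *; erule wild_repsE; simp add: conj_diag_mat22 diag_mat_def field_simps)+
  show "rep_t1 respects wild_rel"
  proof (rule *)
    fix r and \<alpha> :: complex assume "r \<in> wild_reps" "\<alpha> \<noteq> 0"
    thus "rep_t1 (conj_data \<alpha> r) = rep_t1 r"
    proof (cases rule: wild_repsE)
      case (1 a b c d u1 u2 l)
      have inv: "trace (matrix_inv A) = trace A" if "det A = 1" for A :: mat2
        by (subst (1 2) mat22_eta[symmetric], subst matrix_inv_mat22)
           (use that in \<open>simp_all add: det_2\<close>)
      show ?thesis
        using 1 \<open>\<alpha> \<noteq> 0\<close>
        by (simp add: rep_t1_def conj_diag_mat22 inv det_mul del: mat22_mult add: diag_mat_def)
           (simp add: field_simps)
    qed
  qed
qed

lemma coord_wild_class: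
  assumes "r \<in> wild_reps"
  shows "coord_lam (wild_class r) = rep_lam r" "coord_t0 (wild_class r) = rep_t0 r"
    "coord_t1 (wild_class r) = rep_t1 r" "coord_s (wild_class r) = rep_s r"
    "coord_x (wild_class r) = rep_x r" "coord_y (wild_class r) = rep_y r"
  using assms
  by (simp_all add: coord_lam_def coord_t0_def coord_t1_def coord_s_def coord_x_def coord_y_def
      on_class_wild_class coords_respect)

text \<open>\<open>M1_of\<close> solves its defining equation, and \<open>tr M\<^sub>1\<close> equals the trace of its inverse.\<close>

lemma M1_of_eq:
  assumes "(M0, U1, U2, Mh) \<in> wild_reps"
  shows "M0 ** U1 ** U2 ** Mh ** M1_of (M0, U1, U2, Mh) = mat 1"
    "rep_t1 (M0, U1, U2, Mh) = trace (M0 ** U1 ** U2 ** Mh)"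
proof -
  let ?P = "M0 ** U1 ** U2 ** Mh"
  have "det ?P = 1"
    using assms by (auto simp: wild_reps_def det_mul diag_mat_def)
  then obtain a b c d where P: "?P = mat22 a b c d" "a*d - b*c = 1"
    using mat22_eta[of ?P] by (metis det_2)
  show "?P ** M1_of (M0, U1, U2, Mh) = mat 1"
    using P by (simp add: matrix_inv_mat22 mat22_one algebra_simps)
  show "rep_t1 (M0, U1, U2, Mh) = trace ?P"
    using P by (simp add: rep_t1_def matrix_inv_mat22)
qed

end

theory Submission
  imports Defs
begin

text \<open>
  Put \<open>N = U\<^sub>1 U\<^sub>2 Mh\<close>, so that \<open>h_b2\<close> replaces \<open>M\<^sub>0\<close> by \<open>M\<^sub>0' = N\<^sup>-\<^sup>1 M\<^sub>0 N\<close> and keeps the other entries.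
  Conjugation by \<open>N\<close> preserves both \<open>tr M\<^sub>0\<close> and \<open>tr (M\<^sub>0 N)\<close>, hence \<open>t\<^sub>0\<close> and \<open>t\<^sub>1\<close> are fixed.
  Since \<open>U\<^sub>1 U\<^sub>2 = N Mh\<^sup>-\<^sup>1\<close>, the coordinates other than \<open>\<lambda>\<close> are traces of words in \<open>M\<^sub>0\<close>, \<open>N\<close> and
  \<open>Mh\<^sup>\<plusminus>\<^sup>1\<close>, and the factor \<open>\<lambda>\<^sup>-\<^sup>1 - \<lambda> + \<lambda> s\<close> in the formulas is nothing but \<open>tr N\<close>.

  The formulas for \<open>x'\<close> and \<open>y'\<close> are two instances of the identity for
  \<open>tr (A B C) + tr (B A C)\<close> (\<open>trace_triple_swap\<close>), which is the trace form of the polarised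
  Cayley-Hamilton theorem. In \<open>y' = tr (N\<^sup>-\<^sup>1 (M\<^sub>0 N) Mh)\<close>, swapping \<open>N\<^sup>-\<^sup>1\<close> with \<open>M\<^sub>0 N\<close> gives \<open>y\<close>;
  in \<open>x' = tr (M\<^sub>0' N Mh\<^sup>-\<^sup>1)\<close>, swapping \<open>M\<^sub>0'\<close> with \<open>N\<close> gives \<open>x\<close>. This yields

  \<open>y + y' = - tr N x + s t\<^sub>1 + (\<lambda> + \<lambda>\<^sup>-\<^sup>1) t\<^sub>0\<close>,
  \<open>x + x' = - tr N y' + s t\<^sub>0 + (\<lambda> + \<lambda>\<^sup>-\<^sup>1) t\<^sub>1\<close>,

  so \<open>h_b2\<close> first reflects \<open>y\<close> with \<open>x\<close> held fixed and then \<open>x\<close> with \<open>y'\<close> held fixed.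
  Substituting the first relation into the second yields the stated polynomials.
\<close>

text \<open>
  Linearising the Cayley-Hamilton equation \<open>A\<^sup>2 - tr A A + det A = 0\<close> in \<open>A\<close> expresses
  \<open>A B + B A\<close> through \<open>A\<close>, \<open>B\<close> and the identity; multiplying by \<open>C\<close> and taking traces gives this
  identity.
\<close>

lemma trace_triple_swap:
  fixes A B C :: "'a::comm_ring_1^2^2"
  shows "trace (A ** B ** C) + trace (B ** A ** C) =
    trace A * trace (B ** C) + trace B * trace (A ** C) + trace C * trace (A ** B)
    - trace A * trace B * trace C"
  by (simp add: trace_def matrix_matrix_mult_def sum_2 algebra_simps)

lemma matrix_inv_unimodular:
  fixes B :: mat2
  assumes "det B = 1"
  shows "matrix_inv B ** B = mat 1" "B ** matrix_inv B = mat 1"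
proof -
  have "invertible B"
    using assms by (simp add: invertible_det_nz)
  then have "\<exists>C. B ** C = mat 1 \<and> C ** B = mat 1"
    by (simp add: invertible_def)
  then have "B ** matrix_inv B = mat 1 \<and> matrix_inv B ** B = mat 1"
    unfolding matrix_inv_def by (rule someI_ex)
  then show "matrix_inv B ** B = mat 1" "B ** matrix_inv B = mat 1"
    by auto
qed

text \<open>By Cayley-Hamilton, \<open>B\<^sup>-\<^sup>1 = tr B - B\<close> when \<open>det B = 1\<close>.\<close>

lemma trace_mult_matrix_inv:
  fixes A B :: mat2
  assumes "det B = 1"
  shows "trace (A ** matrix_inv B) = trace A * trace B - trace (A ** B)"
proof -
  have "matrix_inv B = mat22 (B$2$2) (- B$1$2) (- B$2$1) (B$1$1)"
    using matrix_inv_mat22[of "B$1$1" "B$2$2" "B$1$2" "B$2$1"] assms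
    by (simp add: mat22_eta det_2)
  then show ?thesis
    by (simp add: trace_def matrix_matrix_mult_def sum_2 algebra_simps)
qed

lemma trace_matrix_inv:
  fixes B :: mat2
  assumes "det B = 1"
  shows "trace (matrix_inv B) = trace B"
  using trace_mult_matrix_inv[OF assms, of "mat 1"]
  by (simp add: trace_I)

lemma trace_conj:
  fixes M N :: mat2
  assumes "det N = 1"
  shows "trace (matrix_inv N ** M ** N) = trace M"
  by (metis assms matrix_inv_unimodular(2) matrix_mul_assoc matrix_mul_lid trace_mul_sym)

text \<open>
  In the application \<open>H\<close> is the formal monodromy, and the traces on the right are,
  after \<open>tr N\<close>, \<open>x\<close>, \<open>s\<close>, \<open>t\<^sub>1\<close>, \<open>\<lambda> + \<lambda>\<^sup>-\<^sup>1\<close> and \<open>t\<^sub>0\<close>. Swapping \<open>N\<^sup>-\<^sup>1\<close> with \<open>M N\<close> produces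
  \<open>tr N tr (M N H)\<close> and the cubic term \<open>- tr N tr (M N) tr H\<close>; together they form \<open>- tr N tr (M N H\<^sup>-\<^sup>1)\<close>.
\<close>

lemma trace_conj_mult:
  fixes M N H :: mat2
  assumes "det N = 1" "det H = 1"
  shows "trace (matrix_inv N ** M ** N ** H) + trace (M ** H) =
    - trace N * trace (M ** N ** matrix_inv H)
    + trace (N ** matrix_inv H) * trace (M ** N) + trace H * trace M"
proof -
  let ?N' = "matrix_inv N"
  have cancel: "(M ** N) ** ?N' = M"
    by (metis assms(1) matrix_inv_unimodular(2) matrix_mul_assoc matrix_mul_rid)
  have s: "trace (?N' ** H) = trace (N ** matrix_inv H)"
    using trace_mul_sym[of ?N' H] trace_mul_sym[of H N]
    by (simp add: trace_mult_matrix_inv assms)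
  show ?thesis
    using trace_triple_swap[of ?N' "M ** N" H]
    by (simp add: cancel trace_conj s trace_matrix_inv trace_mult_matrix_inv[of H "M ** N"]
        matrix_mul_assoc assms algebra_simps)
qed

text \<open>
  The counterpart for \<open>x\<close>, from swapping \<open>N\<^sup>-\<^sup>1 M N\<close> with \<open>N\<close>. It is the trace of \<open>M' H\<close>, with the already conjugated
  matrix \<open>M' = N\<^sup>-\<^sup>1 M N\<close>, that occurs on the right, which makes the second relation involve \<open>y'\<close>
  instead of \<open>y\<close>.
\<close>

lemma trace_conj_mult_inv:
  fixes M N H :: mat2
  assumes "det N = 1" "det H = 1"
  shows "trace (matrix_inv N ** M ** N ** (N ** matrix_inv H)) + trace (M ** (N ** matrix_inv H)) =
    - trace N * trace (matrix_inv N ** M ** N ** H)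
    + trace (N ** matrix_inv H) * trace M + trace H * trace (M ** N)"
proof -
  define M' where "M' = matrix_inv N ** M ** N"
  have NM': "N ** M' = M ** N"
    unfolding M'_def by (metis assms(1) matrix_inv_unimodular(2) matrix_mul_assoc matrix_mul_lid)
  have tr_M'N: "trace (M' ** N) = trace (M ** N)"
    using trace_mul_sym[of M' N] NM' by simp
  have tr_M': "trace M' = trace M"
    unfolding M'_def by (rule trace_conj[OF assms(1)])
  have "trace (M' ** N ** matrix_inv H) + trace (M ** N ** matrix_inv H) =
    - trace N * trace (M' ** H) + trace (N ** matrix_inv H) * trace M + trace H * trace (M ** N)"
    using trace_triple_swap[of M' N "matrix_inv H"]
    by (simp add: NM' tr_M'N tr_M' trace_matrix_inv trace_mult_matrix_inv[of H M'] assms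
        algebra_simps)
  then show ?thesis
    unfolding M'_def by (simp add: matrix_mul_assoc)
qed

text \<open>
  The coordinates are constant on classes, so it suffices to compute them on representatives.
\<close>

lemma rep_braid_sq:
  assumes "r \<in> wild_reps"
  defines "l \<equiv> rep_lam r" and "t0 \<equiv> rep_t0 r" and "t1 \<equiv> rep_t1 r"
    and "s \<equiv> rep_s r" and "x \<equiv> rep_x r" and "y \<equiv> rep_y r"
  defines "w \<equiv> inverse l - l + l * s"
  shows "rep_lam (braid_sq r) = l" "rep_t0 (braid_sq r) = t0" "rep_t1 (braid_sq r) = t1"
    "rep_s (braid_sq r) = s"
    "rep_y (braid_sq r) = - w * x - y + (s * t1 + l * t0 + inverse l * t0)"
    "rep_x (braid_sq r) = w^2 * x + w * y - x - w * (s * t1 + l * t0 + inverse l * t0)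
      + (s * t0 + l * t1 + inverse l * t1)"
proof -
  obtain M u1 u2 k where k: "k \<noteq> 0"
    and r0: "r = (M, mat22 1 u1 0 1, mat22 1 0 u2 1, diag_mat k)"
    using assms(1) unfolding wild_reps_def by blast
  have "l = k"
    by (simp add: l_def r0 diag_mat_def)
  then have l: "l \<noteq> 0" and r1: "r = (M, mat22 1 u1 0 1, mat22 1 0 u2 1, diag_mat l)"
    using k r0 by simp_all
  define U1 where "U1 = mat22 1 u1 0 1"
  define U2 where "U2 = mat22 1 0 u2 1"
  define H where "H = diag_mat l"
  define N where "N = U1 ** U2 ** H"
  have r: "r = (M, U1, U2, H)"
    by (simp add: r1 U1_def U2_def H_def)
  have det_H: "det H = 1" and tr_H: "trace H = l + inverse l"
    using l by (simp_all add: H_def diag_mat_def)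
  have det_N: "det N = 1"
    using det_H by (simp add: N_def det_mul U1_def U2_def)
  have NH: "N ** matrix_inv H = U1 ** U2"
    unfolding N_def by (metis det_H matrix_inv_unimodular(2) matrix_mul_assoc matrix_mul_rid)
  have tr_N: "trace N = w"
    unfolding w_def s_def r
    by (simp add: N_def U1_def U2_def H_def diag_mat_def algebra_simps)
  have br: "braid_sq r = (matrix_inv N ** M ** N, U1, U2, H)"
    by (simp add: r N_def)
  have eqs: "t0 = trace M" "s = trace (N ** matrix_inv H)" "y = trace (M ** H)"
    "x = trace (M ** N ** matrix_inv H)"
    unfolding t0_def s_def x_def y_def r by (simp_all add: NH matrix_mul_assoc[symmetric])
  have eqs': "rep_y (braid_sq r) = trace (matrix_inv N ** M ** N ** H)"
    "rep_x (braid_sq r) = trace (matrix_inv N ** M ** N ** (N ** matrix_inv H))"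
    unfolding br NH by (simp_all add: matrix_mul_assoc)
  have t1: "t1 = trace (M ** N)"
    using M1_of_eq(2) assms(1) unfolding t1_def r by (simp add: N_def matrix_mul_assoc)
  have t1': "rep_t1 (braid_sq r) = trace (matrix_inv N ** (M ** N) ** N)"
    using M1_of_eq(2) braid_sq_in_reps[OF assms(1)] unfolding br
    by (simp add: N_def matrix_mul_assoc)
  show "rep_lam (braid_sq r) = l" "rep_s (braid_sq r) = s"
    unfolding br l_def s_def r by simp_all
  show "rep_t0 (braid_sq r) = t0"
    unfolding br eqs by (simp add: trace_conj det_N)
  show "rep_t1 (braid_sq r) = t1"
    unfolding t1' t1 by (rule trace_conj[OF det_N])
  have y': "rep_y (braid_sq r) + y = - w * x + s * t1 + (l + inverse l) * t0"
    using trace_conj_mult[OF det_N det_H, of M]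
    unfolding tr_N tr_H eqs eqs' t1 .
  have x': "rep_x (braid_sq r) + x = - w * rep_y (braid_sq r) + s * t0 + (l + inverse l) * t1"
    using trace_conj_mult_inv[OF det_N det_H, of M]
    unfolding tr_N tr_H eqs eqs' t1 by (simp only: matrix_mul_assoc)
  have y'_eq: "rep_y (braid_sq r) = - w * x + s * t1 + (l + inverse l) * t0 - y"
    using y' by (simp only: eq_diff_eq)
  then show "rep_y (braid_sq r) = - w * x - y + (s * t1 + l * t0 + inverse l * t0)"
    by (simp add: algebra_simps)
  have "rep_x (braid_sq r) = - w * rep_y (braid_sq r) + s * t0 + (l + inverse l) * t1 - x"
    using x' by (simp only: eq_diff_eq)
  then show "rep_x (braid_sq r) =
    w^2 * x + w * y - x - w * (s * t1 + l * t0 + inverse l * t0)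
      + (s * t0 + l * t1 + inverse l * t1)"
    unfolding y'_eq by (simp add: power2_eq_square algebra_simps)
qed

lemma wild_char_varietyE:
  assumes "c \<in> wild_char_variety"
  obtains r where "r \<in> wild_reps" "c = wild_class r"
  using assms unfolding wild_char_variety_def wild_class_def by (rule quotientE)

theorem proposition3p18:
  "h_b2 \<in> wild_char_variety \<rightarrow> wild_char_variety \<and>
   (\<forall>M0 U1 U2 Mh. (M0, U1, U2, Mh) \<in> wild_reps \<longrightarrow>
      h_b2 (wild_class (M0, U1, U2, Mh)) =
      wild_class (matrix_inv (U1 ** U2 ** Mh) ** M0 ** (U1 ** U2 ** Mh), U1, U2, Mh)) \<and>
   (\<forall>c \<in> wild_char_variety.
      let l = coord_lam c; t0 = coord_t0 c; t1 = coord_t1 c;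
          s = coord_s c; x = coord_x c; y = coord_y c;
          l' = coord_lam (h_b2 c); t0' = coord_t0 (h_b2 c); t1' = coord_t1 (h_b2 c);
          s' = coord_s (h_b2 c); x' = coord_x (h_b2 c); y' = coord_y (h_b2 c)
      in l' = l \<and> t0' = t0 \<and> t1' = t1 \<and>
         s' = s \<and>
         x' = (inverse l - l + l * s)^2 * x + (inverse l - l + l * s) * y - x
              - (inverse l - l + l * s) * (s * t1 + l * t0 + inverse l * t0)
              + (s * t0 + l * t1 + inverse l * t1) \<and>
         y' = - (inverse l - l + l * s) * x - y + (s * t1 + l * t0 + inverse l * t0))"
proof (intro conjI)
  show "h_b2 \<in> wild_char_variety \<rightarrow> wild_char_variety"
  proof
    fix c assume "c \<in> wild_char_variety"
    then show "h_b2 c \<in> wild_char_variety"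
      by (elim wild_char_varietyE) (simp only: h_b2_class braid_sq_in_reps wild_class_in)
  qed
  show "\<forall>M0 U1 U2 Mh. (M0, U1, U2, Mh) \<in> wild_reps \<longrightarrow>
      h_b2 (wild_class (M0, U1, U2, Mh)) =
      wild_class (matrix_inv (U1 ** U2 ** Mh) ** M0 ** (U1 ** U2 ** Mh), U1, U2, Mh)"
    by (simp add: h_b2_class)
next
  show "\<forall>c \<in> wild_char_variety. let l = coord_lam c; t0 = coord_t0 c; t1 = coord_t1 c;
          s = coord_s c; x = coord_x c; y = coord_y c;
          l' = coord_lam (h_b2 c); t0' = coord_t0 (h_b2 c); t1' = coord_t1 (h_b2 c);
          s' = coord_s (h_b2 c); x' = coord_x (h_b2 c); y' = coord_y (h_b2 c)
      in l' = l \<and> t0' = t0 \<and> t1' = t1 \<and>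
         s' = s \<and>
         x' = (inverse l - l + l * s)^2 * x + (inverse l - l + l * s) * y - x
              - (inverse l - l + l * s) * (s * t1 + l * t0 + inverse l * t0)
              + (s * t0 + l * t1 + inverse l * t1) \<and>
         y' = - (inverse l - l + l * s) * x - y + (s * t1 + l * t0 + inverse l * t0)"
    (is "\<forall>c \<in> wild_char_variety. ?coords c")
  proof
    fix c assume "c \<in> wild_char_variety"
    then obtain r where r: "r \<in> wild_reps" "c = wild_class r"
      by (rule wild_char_varietyE)
    then show "?coords c"
      by (simp only: Let_def h_b2_class coord_wild_class braid_sq_in_reps rep_braid_sq simp_thms)
  qed
qed

end
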